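(* Assume that $H\in C^\infty([y_j-3h/2,\,y_j+3h/2])$ and that $p$-th order accurate volume fractions are used to approximate the averaged local height-functions. Then, for $\lambda=1,2$, $$\check{\bar H}^{\check{[\lambda]}}_j = H^{[\lambda]}_j+\mathcal{O}(h^2)+\mathcal{O}(h^{p+1-\lambda}),$$ where the $\mathcal{O}(h^2)$ term is due to the finite difference approximation and the $\mathcal{O}(h^{p+1-\lambda})$ term is due to the approximation of the volume fractions.
   Context: The mesh is uniform and rectilinear with square control volumes $(i,j)$ of width $h$ and centroids $(x_i,y_j)$. Near the cell $(i,j)$ the interface is represented by a local height-function (LHF) $H(y)$ whose principal normal direction is the positive $x$-direction, i.e. the interface is the graph $x=H(y)$ (with $x$ measured relative to $x_i$) and the liquid lies on the side of smaller $x$. $H^{[\lambda]}$ denotes the exact $\lambda$-th derivative of $H$, and $H_j^{[\lambda]}=H^{[\lambda]}(y_j)$. $\mathcal{O}(\cdot)$ is understood as $h\to0$, with the derivatives of $H$ bounded independently of $h$. The averaged LHF is $\bar H(y)=\frac1h\int_{y-h/2}^{y+h/2}H(\tau)\,d\tau$. With $\alpha_{i,j}\in[0,1]$ the exact liquid volume fraction of cell $(i,j)$ (liquid area in the cell divided by $h^2$) and $N_H$ a fixed positive integer (independent of $h$) such that in each of the columns $j-1,j,j+1$ the bottom and top cells $(i-N_H,\cdot)$ and $(i+N_H,\cdot)$ are entirely full and empty, respectively, one has, in each such column, $$\bar H_j:=\bar H(y_j)=\frac1h\sum_{k=-N_H}^{N_H}h^2\alpha_{i+k,j}-\left(N_H+\tfrac12\right)h.$$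 Given approximate volume fractions $\check\alpha$, the approximate averaged LHF is $$\check{\bar H}_j=\frac1h\sum_{k=-N_H}^{N_H}h^2\check\alpha_{i+k,j}-\left(N_H+\tfrac12\right)h.$$ The volume fractions are $p$-th order accurate if $\check\alpha-\alpha=\mathcal{O}(h^p)$ uniformly over cells. The finite difference approximations of the first and second derivative of a grid function $f$ are $$f^{\check{[1]}}_j=\frac{f_{j+1}-f_{j-1}}{2h},\qquad f^{\check{[2]}}_j=\frac{f_{j+1}-2f_j+f_{j-1}}{h^2}.$$ *)

theory Defs
  imports "HOL-Analysis.Analysis" "HOL-Library.Landau_Symbols"
begin

text \<open>
  Derivatives relative to \<open>S\<close>, so that they are one-sided at the end points of a closed interval.
\<close>

primrec deriv_on :: "real set \<Rightarrow> nat \<Rightarrow> (real \<Rightarrow> real) \<Rightarrow> real \<Rightarrow> real" where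
  "deriv_on S 0 f = f"
| "deriv_on S (Suc n) f = (\<lambda>y. vector_derivative (deriv_on S n f) (at y within S))"

definition C_infinity_on :: "real set \<Rightarrow> (real \<Rightarrow> real) \<Rightarrow> bool" where
  "C_infinity_on S f \<longleftrightarrow> (\<forall>n. deriv_on S n f differentiable_on S)"

lemma deriv_on_interior:
  assumes "C_infinity_on S f" "y \<in> interior S"
  shows "deriv_on S n f y = (deriv ^^ n) f y"
  using assms(2)
proof (induction n arbitrary: y)
  case 0
  then show ?case by simp
next
  case (Suc n)
  have at: "at y within S = at y"
    using Suc.prems by (rule at_within_interior)
  have "deriv_on S n f differentiable at y within S"
    using assms(1) Suc.prems interior_subset
    unfolding C_infinity_on_def differentiable_on_def by blast
  then have "(deriv_on S n f has_vector_derivative deriv_on S (Suc n) f y) (at y)"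
    by (simp add: at vector_derivative_works)
  then have "(deriv_on S n f has_field_derivative deriv_on S (Suc n) f y) (at y)"
    by (simp only: has_real_derivative_iff_has_vector_derivative)
  then have "((deriv ^^ n) f has_field_derivative deriv_on S (Suc n) f y) (at y)"
    by (rule has_field_derivative_transform_within_open[where S = "interior S"])
       (use Suc in auto)
  then show ?case
    by (simp add: DERIV_imp_deriv del: deriv_on.simps)
qed

text \<open>Coordinate of the \<open>i\<close>-th centroid in one direction; \<open>c\<close> is the coordinate of centroid \<open>0\<close>.\<close>

definition centroid :: "real \<Rightarrow> real \<Rightarrow> int \<Rightarrow> real" where
  "centroid c h i = c + of_int i * h"

definition cell :: "real \<Rightarrow> real \<times> real \<Rightarrow> (real \<times> real) set" where
  "cell h z = {fst z - h/2 .. fst z + h/2} \<times> {snd z - h/2 .. snd z + h/2}"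

definition volume_fraction :: "(real \<times> real) set \<Rightarrow> real \<Rightarrow> real \<times> real \<Rightarrow> real" where
  "volume_fraction L h z = measure lebesgue (L \<inter> cell h z) / h^2"

text \<open>The cells \<open>(i+k, j+m)\<close> with \<open>\<bar>k\<bar> \<le> N\<close> and \<open>\<bar>m\<bar> \<le> 1\<close>; a column runs in the \<open>x\<close>-direction.\<close>

definition stencil :: "nat \<Rightarrow> int \<Rightarrow> int \<Rightarrow> (int \<times> int) set" where
  "stencil N i j = {i - int N .. i + int N} \<times> {j - 1 .. j + 1}"

text \<open>
  In the part of the plane covered by the stencil around the cell with centroid \<open>(x, y)\<close>, the
  liquid region \<open>L\<close> is bounded by the graph of \<open>H\<close>, where \<open>H\<close> is measured relative to \<open>x\<close>.
\<close>

definition local_height_function ::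
    "nat \<Rightarrow> real \<Rightarrow> real \<times> real \<Rightarrow> (real \<times> real) set \<Rightarrow> (real \<Rightarrow> real) \<Rightarrow> bool" where
  "local_height_function N h z L H \<longleftrightarrow>
     (\<forall>x \<in> {fst z - (real N + 1/2) * h .. fst z + (real N + 1/2) * h}.
      \<forall>y \<in> {snd z - 3*h/2 .. snd z + 3*h/2}. (x, y) \<in> L \<longleftrightarrow> x - fst z \<le> H y)"

definition avg_height :: "real \<Rightarrow> (real \<Rightarrow> real) \<Rightarrow> real \<Rightarrow> real" where
  "avg_height h H y = 1/h * integral {y - h/2 .. y + h/2} H"

definition column_height :: "nat \<Rightarrow> real \<Rightarrow> (int \<Rightarrow> int \<Rightarrow> real) \<Rightarrow> int \<Rightarrow> int \<Rightarrow> real" where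
  "column_height N h a i j =
     1/h * (\<Sum>k = - int N .. int N. h^2 * a (i + k) j) - (real N + 1/2) * h"

definition order_accurate_on ::
    "(real \<Rightarrow> (int \<times> int) set) \<Rightarrow> real \<Rightarrow> (real \<Rightarrow> int \<Rightarrow> int \<Rightarrow> real) \<Rightarrow> (real \<Rightarrow> int \<Rightarrow> int \<Rightarrow> real) \<Rightarrow> bool"
  where
  "order_accurate_on C p a' a \<longleftrightarrow>
     (\<exists>K. \<forall>\<^sub>F h in at_right 0. \<forall>(i, j) \<in> C h. \<bar>a' h i j - a h i j\<bar> \<le> K * h powr p)"

definition finite_difference :: "nat \<Rightarrow> real \<Rightarrow> (int \<Rightarrow> real) \<Rightarrow> int \<Rightarrow> real" where
  "finite_difference l h f j =
     (if l = 1 then (f (j + 1) - f (j - 1)) / (2 * h)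
      else if l = 2 then (f (j + 1) - 2 * f j + f (j - 1)) / h^2
      else undefined)"

end

theory Submission
  imports Defs
begin

text \<open>
  The total error splits at the exact averaged height function.

  Finite difference part: if \<open>F\<close> is a primitive of \<open>H\<close>, the average over a cell of width \<open>h\<close> is a
  difference quotient of \<open>F\<close>, so both finite differences of the averages are combinations of the
  values of \<open>F\<close> at the four points \<open>c \<plusminus> h/2\<close>, \<open>c \<plusminus> 3*h/2\<close>. Taylor expansion of \<open>F\<close> about \<open>c\<close>
  (\<open>primitive_Taylor\<close>), with one-sided derivatives at the end points of the stencil, leaves only
  the wanted derivative of \<open>H\<close> and a remainder, controlled by the third or fourth derivative of
  \<open>H\<close>, which is \<open>O(h\<^sup>2)\<close> after division (\<open>finite_difference_avg_height_error\<close>).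

  Volume fraction part: by Fubini, the liquid area in a cell is the integral over the width of the
  column of the height above the bottom of the cell, truncated to \<open>[0, h]\<close>
  (\<open>measure_below_graph_in_cell\<close>). By continuity, a full bottom cell and an empty top cell force
  the graph to stay within the column, so that the truncated heights add up to the height itself and
  the exact column height is the exact average (\<open>column_height_eq_avg_height\<close>). A perturbation of
  size \<open>O(h powr p)\<close> in the volume fractions thus perturbs the column heights by
  \<open>O(h powr (p + 1))\<close>, and a finite difference for the \<open>l\<close>-th derivative divides this by
  \<open>h ^ l\<close>.
\<close>

section \<open>Finite differences of cell averages\<close>

text \<open>The factorial in the Taylor remainder is dropped: only the power of \<open>h\<close> matters.\<close>

lemma primitive_Taylor:
  fixes H :: "real \<Rightarrow> real" and a b c z B :: real
  assumes smooth: "C_infinity_on {a..b} H"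
    and B: "\<And>t. t \<in> {a..b} \<Longrightarrow> \<bar>deriv_on {a..b} n H t\<bar> \<le> B"
    and c: "c \<in> {a..b}" and z: "z \<in> {a..b}"
  shows "\<bar>integral {a..z} H - (integral {a..c} H
            + (\<Sum>k<n. deriv_on {a..b} k H c * (z - c) ^ Suc k / fact (Suc k)))\<bar>
          \<le> B * \<bar>z - c\<bar> ^ Suc n"
proof -
  \<comment> \<open>\<open>G 0\<close> is a primitive of \<open>H\<close>; its \<open>k\<close>-th derivative is \<open>G k\<close>.\<close>
  define G where
    "G = (\<lambda>k. case k of 0 \<Rightarrow> (\<lambda>t. integral {a..t} H) | Suc m \<Rightarrow> deriv_on {a..b} m H)"
  have diff: "deriv_on {a..b} m H differentiable_on {a..b}" for m
    using smooth by (simp add: C_infinity_on_def)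
  have G_deriv: "(G k has_field_derivative G (Suc k) t) (at t within {a..b})"
    if t: "t \<in> {a..b}" for k t
  proof (cases k)
    case 0
    have "continuous_on {a..b} H"
      using diff[of 0] by (simp add: differentiable_imp_continuous_on)
    then show ?thesis
      using integral_has_real_derivative[of a b H t] t 0 by (simp add: G_def)
  next
    case (Suc m)
    have "deriv_on {a..b} m H differentiable at t within {a..b}"
      using diff[of m] t by (simp add: differentiable_on_def)
    then show ?thesis
      using Suc by (simp add: G_def vector_derivative_works
          has_real_derivative_iff_has_vector_derivative)
  qed
  have "norm (G 0 z - (\<Sum>k\<le>n. G k c * (z - c) ^ k / fact k)) \<le> B * norm (z - c) ^ Suc n / fact n"
  proof (rule field_Taylor[where S = "{a..b}"])
    show "norm (G (Suc n) t) \<le> B" if "t \<in> {a..b}" for t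
      using B[OF that] by (simp add: G_def)
  qed (use G_deriv c z in auto)
  also have "\<dots> \<le> B * norm (z - c) ^ Suc n"
  proof -
    have "0 \<le> B" using B[OF c] by linarith
    then have "0 \<le> B * norm (z - c) ^ Suc n" by simp
    then have "B * norm (z - c) ^ Suc n / fact n \<le> B * norm (z - c) ^ Suc n / 1"
      by (intro divide_left_mono fact_ge_1) simp_all
    then show ?thesis by simp
  qed
  also have "(\<Sum>k\<le>n. G k c * (z - c) ^ k / fact k) = integral {a..c} H
      + (\<Sum>k<n. deriv_on {a..b} k H c * (z - c) ^ Suc k / fact (Suc k))"
    by (simp add: sum.atMost_shift G_def)
  finally show ?thesis by (simp add: G_def)
qed

lemma avg_height_eq_primitive:
  assumes "continuous_on {a..b} H" "a \<le> y - h/2" "y + h/2 \<le> b" "0 < h"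
  shows "avg_height h H y = (integral {a..y + h/2} H - integral {a..y - h/2} H) / h"
proof -
  have "H integrable_on {a..y + h/2}"
    using assms by (intro integrable_continuous_interval continuous_on_subset[OF assms(1)]) auto
  then have "integral {a..y - h/2} H + integral {y - h/2..y + h/2} H = integral {a..y + h/2} H"
    using assms by (intro Henstock_Kurzweil_Integration.integral_combine) auto
  then show ?thesis by (simp add: avg_height_def field_simps)
qed

text \<open>
  The finite difference for the \<open>l\<close>-th derivative needs a bound on the derivative of order \<open>l + 2\<close>
  only, that is, one on the derivative of order \<open>l + 3\<close> of the primitive.
  The constant is \<open>8 * 2 ^ 5\<close>: for \<open>l = 2\<close>, the weights of the four values of the primitive have
  total size 8, and each remainder is at most \<open>B * (2 * h) ^ 5\<close>.
\<close>

lemma finite_difference_avg_height_error: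
  fixes H :: "real \<Rightarrow> real" and c h B :: real
  defines "S \<equiv> {c - 3*h/2..c + 3*h/2}"
  assumes h: "0 < h" and l: "l \<in> {1, 2}"
    and smooth: "C_infinity_on S H"
    and B: "\<And>t. t \<in> S \<Longrightarrow> \<bar>deriv_on S (l + 2) H t\<bar> \<le> B"
    and f: "f j = avg_height h H c" "f (j + 1) = avg_height h H (c + h)"
      "f (j - 1) = avg_height h H (c - h)"
  shows "\<bar>finite_difference l h f j - (deriv ^^ l) H c\<bar> \<le> 256 * B * h^2"
proof -
  define F where "F z = integral {c - 3*h/2..z} H" for z
  define D where "D k = deriv_on S k H c" for k
  \<comment> \<open>\<open>T s\<close> is the Taylor polynomial of the primitive \<open>F\<close> at \<open>c + s * h\<close>, and \<open>r s\<close> the remainder.\<close>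
  define T where "T s = F c + (\<Sum>k<l+2. D k * (s * h) ^ Suc k / fact (Suc k))" for s
  define r where "r s = F (c + s * h) - T s" for s
  have B0: "0 \<le> B" using B[of c] h by (force simp: S_def)
  have D_deriv: "(deriv ^^ l) H c = D l"
    using deriv_on_interior[OF smooth, of c l] h by (simp add: S_def D_def)
  have r: "\<bar>r s\<bar> \<le> B * (2 * h) ^ (l + 3)" if s: "\<bar>s\<bar> \<le> 3/2" for s
  proof -
    have sh: "\<bar>s * h\<bar> \<le> 3/2 * h" using s h by (simp add: abs_mult)
    then have "s * h \<le> 3/2 * h" "- (3/2 * h) \<le> s * h" by linarith+
    then have cs: "c \<in> S" "c + s * h \<in> S" using h unfolding S_def atLeastAtMost_iff by linarith+
    have "\<bar>r s\<bar> \<le> B * \<bar>s * h\<bar> ^ Suc (l + 2)"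
      using primitive_Taylor[OF smooth[unfolded S_def] B[unfolded S_def] cs[unfolded S_def]]
      unfolding r_def T_def F_def D_def S_def add_diff_cancel_left' .
    also have "\<dots> = B * \<bar>s * h\<bar> ^ (l + 3)"
      by (simp add: numeral_3_eq_3)
    also have "\<dots> \<le> B * (2 * h) ^ (l + 3)"
      using sh h B0 by (intro mult_left_mono power_mono) auto
    finally show ?thesis .
  qed
  have cont: "continuous_on S H"
    using smooth by (auto simp: C_infinity_on_def dest!: spec[of _ 0]
        intro: differentiable_imp_continuous_on)
  define F1 F2 F3 F4 where
    "F1 = F (c + 3*h/2)" and "F2 = F (c + h/2)" and "F3 = F (c - h/2)" and "F4 = F (c - 3*h/2)"
  have f_F: "f j = (F2 - F3) / h" "f (j + 1) = (F1 - F2) / h" "f (j - 1) = (F3 - F4) / h"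
  proof -
    have pts: "c + h + h/2 = c + 3*h/2" "c + h - h/2 = c + h/2"
      "c - h + h/2 = c - h/2" "c - h - h/2 = c - 3*h/2"
      by (simp_all add: field_simps)
    have avg: "avg_height h H y = (F (y + h/2) - F (y - h/2)) / h"
      if "c - 3*h/2 \<le> y - h/2" "y + h/2 \<le> c + 3*h/2" for y
      unfolding F_def using cont h that by (intro avg_height_eq_primitive) (auto simp: S_def)
    show "f j = (F2 - F3) / h"
      using avg[of c] h by (simp add: f F2_def F3_def)
    show "f (j + 1) = (F1 - F2) / h"
      using avg[of "c + h"] h by (simp add: f F1_def F2_def pts)
    show "f (j - 1) = (F3 - F4) / h"
      using avg[of "c - h"] h by (simp add: f F3_def F4_def pts)
  qed
  have F_split: "F1 = T (3/2) + r (3/2)" "F2 = T (1/2) + r (1/2)"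
    "F3 = T (-1/2) + r (-1/2)" "F4 = T (-3/2) + r (-3/2)"
    by (simp_all add: r_def F1_def F2_def F3_def F4_def)
  have rb: "\<bar>r (3/2)\<bar> \<le> B * (2 * h) ^ (l + 3)" "\<bar>r (1/2)\<bar> \<le> B * (2 * h) ^ (l + 3)"
    "\<bar>r (-1/2)\<bar> \<le> B * (2 * h) ^ (l + 3)" "\<bar>r (-3/2)\<bar> \<le> B * (2 * h) ^ (l + 3)"
    by (rule r, simp)+
  consider "l = 1" | "l = 2" using l by auto
  then show ?thesis
  proof cases
    case 1
    \<comment> \<open>By symmetry the odd powers cancel; of the even ones, only the square remains.\<close>
    have T: "T (3/2) - T (1/2) - T (-1/2) + T (-3/2) = 2 * h^2 * D 1"
      by (simp add: T_def 1 eval_nat_numeral)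
    have "finite_difference l h f j - (deriv ^^ l) H c
        = ((F1 - F2) / h - (F3 - F4) / h) / (2 * h) - D 1"
      unfolding D_deriv by (simp add: finite_difference_def f_F 1)
    also have "\<dots> = ((F1 - F2 - F3 + F4) - 2 * h^2 * D 1) / (2 * h^2)"
      using h by (simp add: field_simps power2_eq_square)
    also have "\<dots> = (r (3/2) - r (1/2) - r (-1/2) + r (-3/2)) / (2 * h^2)"
      unfolding F_split T[symmetric] by simp
    finally have *: "finite_difference l h f j - (deriv ^^ l) H c
        = (r (3/2) - r (1/2) - r (-1/2) + r (-3/2)) / (2 * h^2)" .
    have "\<bar>r (3/2) - r (1/2) - r (-1/2) + r (-3/2)\<bar> \<le> 4 * (B * (2 * h) ^ 4)"
      using rb 1 by (simp add: abs_le_iff)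
    also have "\<dots> = (32 * B * h^2) * (2 * h^2)"
      by (simp add: power_mult_distrib eval_nat_numeral)
    finally have "\<bar>finite_difference l h f j - (deriv ^^ l) H c\<bar> \<le> 32 * B * h^2"
      unfolding * using h by (simp add: abs_divide divide_le_eq)
    also have "\<dots> \<le> 256 * B * h^2"
      using B0 by (intro mult_right_mono) auto
    finally show ?thesis .
  next
    case 2
    \<comment> \<open>By antisymmetry the even powers cancel, and the weights 1, -3, 3, -1 remove the linear term.\<close>
    have T: "T (3/2) - 3 * T (1/2) + 3 * T (-1/2) - T (-3/2) = h^3 * D 2"
      by (simp add: T_def 2 eval_nat_numeral)
    have "finite_difference l h f j - (deriv ^^ l) H c
        = ((F1 - F2) / h - 2 * ((F2 - F3) / h) + (F3 - F4) / h) / h^2 - D 2"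
      unfolding D_deriv by (simp add: finite_difference_def f_F 2)
    also have "\<dots> = ((F1 - 3 * F2 + 3 * F3 - F4) - h^3 * D 2) / h^3"
      using h by (simp add: field_simps eval_nat_numeral)
    also have "\<dots> = (r (3/2) - 3 * r (1/2) + 3 * r (-1/2) - r (-3/2)) / h^3"
      unfolding F_split T[symmetric] by (simp add: algebra_simps)
    finally have *: "finite_difference l h f j - (deriv ^^ l) H c
        = (r (3/2) - 3 * r (1/2) + 3 * r (-1/2) - r (-3/2)) / h^3" .
    have "\<bar>r (3/2) - 3 * r (1/2) + 3 * r (-1/2) - r (-3/2)\<bar> \<le> 8 * (B * (2 * h) ^ 5)"
      using rb 2 by (simp add: abs_le_iff)
    also have "\<dots> = (256 * B * h^2) * h^3"
      by (simp add: power_mult_distrib eval_nat_numeral)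
    finally show ?thesis
      unfolding * using h by (simp add: abs_divide divide_le_eq)
  qed
qed

section \<open>Volume fractions and column heights\<close>

text \<open>
  The height \<open>u\<close> above the bottom of a cell of width \<open>h\<close>, truncated to the cell: the length of the
  part of the cell below \<open>u\<close>.
\<close>

definition truncated_height :: "real \<Rightarrow> real \<Rightarrow> real" where
  "truncated_height h u = min h (max 0 u)"

lemma truncated_height_bounds:
  "0 < h \<Longrightarrow> 0 \<le> truncated_height h u" "0 < h \<Longrightarrow> truncated_height h u \<le> h"
  by (auto simp: truncated_height_def)

lemma continuous_on_truncated_height [continuous_intros]:
  "continuous_on S f \<Longrightarrow> continuous_on S (\<lambda>y. truncated_height h (f y))"
  unfolding truncated_height_def by (intro continuous_intros)

text \<open>
  Cells stacked on top of each other: the truncated heights, each measured from the bottom of its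
  cell, add up to the height truncated to the whole stack.
\<close>

lemma sum_truncated_height:
  assumes "0 < h"
  shows "(\<Sum>k<n. truncated_height h (u - real k * h)) = min (real n * h) (max 0 u)"
proof (induction n)
  case 0
  then show ?case by simp
next
  case (Suc n)
  have step: "min z (max 0 u) + min h (max 0 (u - z)) = min (z + h) (max 0 u)" if "0 \<le> z" for z
    using that assms by (auto simp: min_def max_def)
  have "0 \<le> real n * h" using assms by simp
  from step[OF this] show ?case
    using Suc by (simp add: truncated_height_def algebra_simps)
qed

lemma sum_symmetric_int_interval:
  fixes f :: "int \<Rightarrow> 'a::comm_monoid_add"
  shows "(\<Sum>k = - int N .. int N. f k) = (\<Sum>k<2*N+1. f (int k - int N))"
  by (rule sum.reindex_bij_witness[where i = "\<lambda>k. int k - int N" and j = "\<lambda>k. nat (k + int N)"])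
     auto

lemma measure_below_graph_in_cell:
  fixes H :: "real \<Rightarrow> real" and a b c h :: real
  defines "Y \<equiv> {b - h/2..b + h/2}"
  assumes h: "0 < h" and H: "continuous_on Y H"
    and L: "\<And>x y. x \<in> {a - h/2..a + h/2} \<Longrightarrow> y \<in> Y \<Longrightarrow> (x, y) \<in> L \<longleftrightarrow> x - c \<le> H y"
  shows "measure lebesgue (L \<inter> cell h (a, b))
          = integral Y (\<lambda>y. truncated_height h (H y + c - (a - h/2)))"
proof -
  define g where "g y = truncated_height h (H y + c - (a - h/2))" for y
  define A where "A = {z \<in> {a - h/2..a + h/2} \<times> Y. fst z \<le> H (snd z) + c}"
  have A_eq: "L \<inter> cell h (a, b) = A"
    using L by (auto simp: A_def cell_def Y_def)
  have g_nonneg: "0 \<le> g y" for y using h by (simp add: g_def truncated_height_bounds)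
  have "continuous_on Y g"
    unfolding g_def by (intro continuous_intros H)
  then have g_int: "(g has_integral integral Y g) Y"
    unfolding Y_def by (intro integrable_integral integrable_continuous_interval)
  have "closed A"
    unfolding A_def
  proof (rule continuous_on_closed_Collect_le)
    show "continuous_on ({a - h/2..a + h/2} \<times> Y) (\<lambda>z. H (snd z) + c)"
      by (intro continuous_intros continuous_on_compose2[OF H]) auto
    show "closed ({a - h/2..a + h/2} \<times> Y)"
      by (auto simp: Y_def intro: closed_Times)
  qed (intro continuous_intros)
  then have A_sets: "A \<in> sets borel" by simp
  have "emeasure lborel A = emeasure (lborel \<Otimes>\<^sub>M lborel) A"
    by (simp add: lborel_prod)
  also have "\<dots> = (\<integral>\<^sup>+y. emeasure lborel ((\<lambda>x. (x, y)) -` A) \<partial>lborel)"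
    by (rule lborel_pair.emeasure_pair_measure_alt2) (use A_sets in \<open>unfold lborel_prod sets_lborel\<close>)
  also have "\<dots> = (\<integral>\<^sup>+y. ennreal (g y) * indicator Y y \<partial>lborel)"
  proof (rule nn_integral_cong)
    fix y
    show "emeasure lborel ((\<lambda>x. (x, y)) -` A) = ennreal (g y) * indicator Y y"
    proof (cases "y \<in> Y")
      case True
      then have "(\<lambda>x. (x, y)) -` A = {a - h/2..min (a + h/2) (H y + c)}"
        by (auto simp: A_def)
      then show ?thesis
        using True h by (auto simp: emeasure_lborel_Icc_eq g_def truncated_height_def min_def max_def
            intro!: arg_cong[where f = ennreal])
    next
      case False
      then show ?thesis by (simp add: A_def vimage_def)
    qed
  qed
  also have "\<dots> = ennreal (integral Y g)"
    using g_nonneg g_int by (rule nn_integral_has_integral_lebesgue')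
  finally have "emeasure lborel A = ennreal (integral Y g)" .
  moreover have "0 \<le> integral Y g"
    using g_int g_nonneg by (rule has_integral_nonneg)
  ultimately have "measure lborel A = integral Y g"
    by (simp add: measure_def)
  then show ?thesis
    using A_sets by (simp add: A_eq g_def[abs_def])
qed

text \<open>
  Neither \<open>H \<ge> - (N + 1/2) * h\<close> nor \<open>H \<le> (N + 1/2) * h\<close> is assumed: both are consequences of the
  full bottom cell and the empty top cell. Only the values of \<open>\<alpha>\<close> in the column matter.
\<close>

lemma column_height_eq_avg_height:
  fixes H :: "real \<Rightarrow> real" and h X b :: real and L :: "(real \<times> real) set"
  defines "Y \<equiv> {b - h/2..b + h/2}"
  assumes h: "0 < h" and H: "continuous_on Y H"
    and L: "\<And>x y. x \<in> {X - (real N + 1/2) * h..X + (real N + 1/2) * h} \<Longrightarrow> y \<in> Y \<Longrightarrow>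
              (x, y) \<in> L \<longleftrightarrow> x - X \<le> H y"
    and \<alpha>: "\<And>k. \<bar>k\<bar> \<le> int N \<Longrightarrow> \<alpha> (i + k) j = volume_fraction L h (X + of_int k * h, b)"
    and full: "\<alpha> (i - int N) j = 1" and empty: "\<alpha> (i + int N) j = 0"
  shows "column_height N h \<alpha> i j = avg_height h H b"
proof -
  \<comment> \<open>\<open>u\<close> is the height above the bottom of the column; subtracting \<open>k * h\<close> gives the height above
    the bottom of its \<open>k\<close>-th cell, counted from 0.\<close>
  define u where "u y = H y + (real N + 1/2) * h" for y
  define t where "t k y = truncated_height h (u y - real k * h)" for k y
  have t_cont: "continuous_on Y (t k)" for k
    unfolding t_def u_def by (intro continuous_intros H)
  have area: "h^2 * \<alpha> (i + (int k - int N)) j = integral Y (t k)" if k: "k < 2*N + 1" for k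
  proof -
    define a where "a = X + of_int (int k - int N) * h"
    have "0 \<le> real k * h" "real k * h \<le> 2 * real N * h"
      using k h by (auto intro!: mult_right_mono)
    then have "{a - h/2..a + h/2} \<subseteq> {X - (real N + 1/2) * h..X + (real N + 1/2) * h}"
      by (auto simp: a_def algebra_simps)
    then have "measure lebesgue (L \<inter> cell h (a, b))
        = integral Y (\<lambda>y. truncated_height h (H y + X - (a - h/2)))"
      using measure_below_graph_in_cell[of h b H a L X] h H L unfolding Y_def by blast
    also have "(\<lambda>y. truncated_height h (H y + X - (a - h/2))) = t k"
      by (auto simp: t_def u_def a_def algebra_simps)
    finally show ?thesis
      using \<alpha>[of "int k - int N"] k h by (simp add: volume_fraction_def a_def)
  qed
  \<comment> \<open>The integral of \<open>h - t 0\<close>, a nonnegative continuous function, vanishes; hence so does the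
    function, at every point.\<close>
  have bottom: "t 0 y = h" if y: "y \<in> Y" for y
  proof -
    have "integral Y (t 0) = h * h"
      using area[of 0] full by (simp add: power2_eq_square)
    then have "integral Y (\<lambda>y. h - t 0 y) = 0"
      using h t_cont[of 0] unfolding Y_def
      by (subst Henstock_Kurzweil_Integration.integral_diff)
         (auto intro: integrable_continuous_interval)
    then show ?thesis
      using integral_eq_0_iff[of "b - h/2" "b + h/2" "\<lambda>y. h - t 0 y"] y h t_cont[of 0]
        truncated_height_bounds
      unfolding Y_def t_def by (fastforce intro: continuous_intros)
  qed
  have top: "t (2*N) y = 0" if y: "y \<in> Y" for y
  proof -
    have "integral Y (t (2*N)) = 0"
      using area[of "2*N"] empty by simp
    then show ?thesis
      using integral_eq_0_iff[of "b - h/2" "b + h/2" "t (2*N)"] y h t_cont[of "2*N"]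
        truncated_height_bounds
      unfolding Y_def t_def by fastforce
  qed
  have "(\<Sum>k = - int N .. int N. h^2 * \<alpha> (i + k) j) = (\<Sum>k<2*N+1. integral Y (t k))"
    using area by (simp add: sum_symmetric_int_interval del: sum.lessThan_Suc)
  also have "\<dots> = integral Y (\<lambda>y. \<Sum>k<2*N+1. t k y)"
    using t_cont unfolding Y_def
    by (subst Henstock_Kurzweil_Integration.integral_sum) (auto intro: integrable_continuous_interval)
  also have "\<dots> = integral Y u"
  proof (rule Henstock_Kurzweil_Integration.integral_cong)
    fix y assume y: "y \<in> Y"
    \<comment> \<open>The graph is above the bottom cell and below the top one, so the truncation has no effect.\<close>
    have "0 \<le> u y" "u y \<le> real (2*N+1) * h"
      using bottom[OF y] top[OF y] h
      by (auto simp: t_def truncated_height_def min_def max_def algebra_simps split: if_splits)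
    then show "(\<Sum>k<2*N+1. t k y) = u y"
      unfolding t_def sum_truncated_height[OF h] by simp
  qed
  also have "\<dots> = integral Y H + h * ((real N + 1/2) * h)"
    unfolding u_def using h H unfolding Y_def
    by (subst Henstock_Kurzweil_Integration.integral_add) (auto intro: integrable_continuous_interval)
  finally show ?thesis
    using h unfolding column_height_def avg_height_def Y_def by (simp add: field_simps)
qed

lemma column_height_perturbation:
  assumes h: "0 < h" and \<delta>: "\<And>k. \<bar>k\<bar> \<le> int N \<Longrightarrow> \<bar>a (i + k) j - a' (i + k) j\<bar> \<le> \<delta>"
  shows "\<bar>column_height N h a i j - column_height N h a' i j\<bar> \<le> real (2*N+1) * h * \<delta>"
proof -
  have "column_height N h a i j - column_height N h a' i j
      = h * (\<Sum>k = - int N .. int N. a (i + k) j - a' (i + k) j)"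
    using h by (simp add: column_height_def sum_subtractf sum_distrib_left[symmetric]
        field_simps power2_eq_square)
  also have "\<bar>\<dots>\<bar> \<le> h * (\<Sum>k = - int N .. int N. \<delta>)"
  proof -
    have "\<bar>\<Sum>k = - int N .. int N. a (i + k) j - a' (i + k) j\<bar> \<le> (\<Sum>k = - int N .. int N. \<delta>)"
      by (rule order_trans[OF sum_abs sum_mono]) (use \<delta> in \<open>auto simp: abs_le_iff\<close>)
    then show ?thesis using h by (simp add: abs_mult)
  qed
  also have "\<dots> = real (2*N+1) * h * \<delta>"
    by simp
  finally show ?thesis .
qed

lemma finite_difference_perturbation:
  assumes h: "0 < h" and l: "l \<in> {1, 2}"
    and \<epsilon>: "\<And>n. n \<in> {j - 1..j + 1} \<Longrightarrow> \<bar>f n - g n\<bar> \<le> \<epsilon>"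
  shows "\<bar>finite_difference l h f j - finite_difference l h g j\<bar> \<le> 4 * \<epsilon> / h ^ l"
proof -
  have \<epsilon>s: "\<bar>f j - g j\<bar> \<le> \<epsilon>" "\<bar>f (j + 1) - g (j + 1)\<bar> \<le> \<epsilon>" "\<bar>f (j - 1) - g (j - 1)\<bar> \<le> \<epsilon>"
    by (auto intro: \<epsilon>)
  then have \<epsilon>0: "0 \<le> \<epsilon>" by linarith
  consider "l = 1" | "l = 2" using l by auto
  then show ?thesis
  proof cases
    case 1
    have "finite_difference l h f j - finite_difference l h g j
        = ((f (j + 1) - g (j + 1)) - (f (j - 1) - g (j - 1))) / (2 * h)"
      using h 1 by (simp add: finite_difference_def field_simps)
    moreover have "\<bar>(f (j + 1) - g (j + 1)) - (f (j - 1) - g (j - 1))\<bar> \<le> 8 * \<epsilon>"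
      using \<epsilon>s \<epsilon>0 by linarith
    ultimately show ?thesis
      using h 1 by (simp add: abs_divide divide_le_eq)
  next
    case 2
    have "finite_difference l h f j - finite_difference l h g j
        = ((f (j + 1) - g (j + 1)) - 2 * (f j - g j) + (f (j - 1) - g (j - 1))) / h^2"
      using h 2 by (simp add: finite_difference_def field_simps)
    moreover have
      "\<bar>(f (j + 1) - g (j + 1)) - 2 * (f j - g j) + (f (j - 1) - g (j - 1))\<bar> \<le> 4 * \<epsilon>"
    proof -
      have "\<bar>a - 2 * b + c\<bar> \<le> 4 * \<epsilon>" if "\<bar>a\<bar> \<le> \<epsilon>" "\<bar>b\<bar> \<le> \<epsilon>" "\<bar>c\<bar> \<le> \<epsilon>" for a b c
        using that by linarith
      then show ?thesis using \<epsilon>s by blast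
    qed
    ultimately show ?thesis
      using h 2 by (simp add: abs_divide divide_right_mono)
  qed
qed

section \<open>The error estimate\<close>

theorem lemma3:
  fixes N l :: nat
    and p :: real
    and x0 y0 :: "real \<Rightarrow> real"
    and i j :: "real \<Rightarrow> int"
    and L :: "real \<Rightarrow> (real \<times> real) set"
    and H :: "real \<Rightarrow> real \<Rightarrow> real"
    and \<alpha> \<alpha>' :: "real \<Rightarrow> int \<Rightarrow> int \<Rightarrow> real"
    and x y :: "real \<Rightarrow> int \<Rightarrow> real"
  defines "x \<equiv> \<lambda>h. centroid (x0 h) h"
    and "y \<equiv> \<lambda>h. centroid (y0 h) h"
    and "\<alpha> \<equiv> \<lambda>h m n. volume_fraction (L h) h (x h m, y h n)"
  assumes "N > 0"
    and "l \<in> {1, 2}"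
    and lhf: "\<forall>\<^sub>F h in at_right 0. local_height_function N h (x h (i h), y h (j h)) (L h) (H h)"
    and full_empty: "\<forall>\<^sub>F h in at_right 0. \<forall>n \<in> {j h - 1 .. j h + 1}.
          \<alpha> h (i h - int N) n = 1 \<and> \<alpha> h (i h + int N) n = 0"
    and smooth: "\<forall>\<^sub>F h in at_right 0.
          C_infinity_on {y h (j h) - 3*h/2 .. y h (j h) + 3*h/2} (H h)"
    and bounded_derivs: "\<And>k. k \<ge> 1 \<Longrightarrow> \<exists>B. \<forall>\<^sub>F h in at_right 0.
          \<forall>t \<in> {y h (j h) - 3*h/2 .. y h (j h) + 3*h/2}.
            \<bar>deriv_on {y h (j h) - 3*h/2 .. y h (j h) + 3*h/2} k (H h) t\<bar> \<le> B"
    and accurate: "order_accurate_on (\<lambda>h. stencil N (i h) (j h)) p \<alpha>' \<alpha>"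
  shows "\<exists>E_fd E_vf.
      (\<forall>h>0. finite_difference l h (column_height N h (\<alpha>' h) (i h)) (j h)
               = (deriv ^^ l) (H h) (y h (j h)) + E_fd h + E_vf h) \<and>
      (\<forall>h>0. E_fd h = finite_difference l h (\<lambda>n. avg_height h (H h) (y h n)) (j h)
                        - (deriv ^^ l) (H h) (y h (j h))) \<and>
      (\<forall>h>0. E_vf h = finite_difference l h (column_height N h (\<alpha>' h) (i h)) (j h)
                        - finite_difference l h (\<lambda>n. avg_height h (H h) (y h n)) (j h)) \<and>
      E_fd \<in> O[at_right 0](\<lambda>h. h^2) \<and>
      E_vf \<in> O[at_right 0](\<lambda>h. h powr (p + 1 - real l))"
proof -
  define E_fd where "E_fd h = finite_difference l h (\<lambda>n. avg_height h (H h) (y h n)) (j h)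
                        - (deriv ^^ l) (H h) (y h (j h))" for h
  define E_vf where "E_vf h = finite_difference l h (column_height N h (\<alpha>' h) (i h)) (j h)
                        - finite_difference l h (\<lambda>n. avg_height h (H h) (y h n)) (j h)" for h
  have l: "l \<in> {1, 2}" by fact
  have pos: "\<forall>\<^sub>F h in at_right 0. (0::real) < h"
    by (rule eventually_at_right_less)
  have y_shift: "y h (j h + 1) = y h (j h) + h" "y h (j h - 1) = y h (j h) - h" for h
    by (simp_all add: y_def centroid_def algebra_simps)

  have fd: "E_fd \<in> O[at_right 0](\<lambda>h. h^2)"
  proof -
    obtain B where B: "\<forall>\<^sub>F h in at_right 0. \<forall>t \<in> {y h (j h) - 3*h/2 .. y h (j h) + 3*h/2}.
        \<bar>deriv_on {y h (j h) - 3*h/2 .. y h (j h) + 3*h/2} (l + 2) (H h) t\<bar> \<le> B"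
      using bounded_derivs[of "l + 2"] by auto
    have "\<forall>\<^sub>F h in at_right 0. norm (E_fd h) \<le> (256 * B) * norm (h^2)"
      using pos smooth B
    proof eventually_elim
      case (elim h)
      then have "\<bar>E_fd h\<bar> \<le> 256 * B * h^2"
        unfolding E_fd_def
        by (intro finite_difference_avg_height_error l) (auto simp: y_shift)
      then show ?case by simp
    qed
    then show ?thesis by (rule bigoI)
  qed

  have vf: "E_vf \<in> O[at_right 0](\<lambda>h. h powr (p + 1 - real l))"
  proof -
    obtain K where K: "\<forall>\<^sub>F h in at_right 0. \<forall>(m, n) \<in> stencil N (i h) (j h).
        \<bar>\<alpha>' h m n - \<alpha> h m n\<bar> \<le> K * h powr p"
      using accurate unfolding order_accurate_on_def by blast
    have "\<forall>\<^sub>F h in at_right 0.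
        norm (E_vf h) \<le> (4 * real (2*N+1) * K) * norm (h powr (p + 1 - real l))"
      using pos smooth lhf full_empty K
    proof eventually_elim
      case (elim h)
      have h: "0 < h" by fact
      have cont: "continuous_on {y h (j h) - 3*h/2 .. y h (j h) + 3*h/2} (H h)"
        using elim(2) by (auto simp: C_infinity_on_def dest!: spec[of _ 0]
            intro: differentiable_imp_continuous_on)
      have "\<bar>column_height N h (\<alpha>' h) (i h) n - avg_height h (H h) (y h n)\<bar>
          \<le> real (2*N+1) * h * (K * h powr p)" if n: "n \<in> {j h - 1 .. j h + 1}" for n
      proof -
        have sub: "{y h n - h/2 .. y h n + h/2} \<subseteq> {y h (j h) - 3*h/2 .. y h (j h) + 3*h/2}"
        proof -
          have "n = j h - 1 \<or> n = j h \<or> n = j h + 1" using n by auto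
          then show ?thesis using h by (auto simp: y_shift)
        qed
        have "column_height N h (\<alpha> h) (i h) n = avg_height h (H h) (y h n)"
        proof (rule column_height_eq_avg_height[OF h])
          show "continuous_on {y h n - h/2 .. y h n + h/2} (H h)"
            using cont sub by (rule continuous_on_subset)
          show "(s, t) \<in> L h \<longleftrightarrow> s - x h (i h) \<le> H h t"
            if "s \<in> {x h (i h) - (real N + 1/2) * h .. x h (i h) + (real N + 1/2) * h}"
              "t \<in> {y h n - h/2 .. y h n + h/2}" for s t
            using elim(3) that sub unfolding local_height_function_def fst_conv snd_conv by blast
          show "\<alpha> h (i h + k) n = volume_fraction (L h) h (x h (i h) + of_int k * h, y h n)" for k
            by (simp add: \<alpha>_def x_def centroid_def algebra_simps)
        qed (use elim(4) n in auto)
        moreover have "\<bar>\<alpha>' h (i h + k) n - \<alpha> h (i h + k) n\<bar> \<le> K * h powr p"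
          if "\<bar>k\<bar> \<le> int N" for k
          using elim(5) n that by (auto simp: stencil_def abs_le_iff)
        ultimately show ?thesis
          using column_height_perturbation[OF h, of N "\<alpha>' h" "i h" n "\<alpha> h" "K * h powr p"] by simp
      qed
      then have "\<bar>E_vf h\<bar> \<le> 4 * (real (2*N+1) * h * (K * h powr p)) / h ^ l"
        unfolding E_vf_def by (rule finite_difference_perturbation[OF h l])
      also have "\<dots> = (4 * real (2*N+1) * K) * h powr (p + 1 - real l)"
        using h by (simp add: powr_add powr_diff powr_realpow)
      finally show ?case by simp
    qed
    then show ?thesis by (rule bigoI)
  qed

  show ?thesis
    by (rule exI[of _ E_fd], rule exI[of _ E_vf]) (use fd vf in \<open>simp add: E_fd_def E_vf_def\<close>)
qed

end
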